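(* Let $T>0$, let $d\ge 0$ be an integer, let $\Omega\subset\mathbb{R}^{d+1}$ be a bounded open set with boundary of class $\mathcal{C}^1$, and let $H:\mathbb{R}^{d+1}\to\mathbb{R}$ be continuous, coercive and quasi-convex. Let $u:(0,T)\times\bar\Omega\to\mathbb{R}$ be locally bounded and such that its upper semi-continuous envelope satisfies $$u^*(t,x)=\limsup_{(s,y)\to(t,x),\ y\in\Omega}u^*(s,y)\qquad\text{for all }(t,x)\in(0,T)\times\partial\Omega .$$ Then $u$ is a viscosity solution of the state constraint problem $$\left\{\begin{array}{ll} u_t+H(\nabla u)\ge 0 & \text{in }(0,T)\times\bar\Omega,\\ u_t+H(\nabla u)\le 0 & \text{in }(0,T)\times\Omega\end{array}\right.$$ if and only if $u$ is a viscosity solution of the flux-limited problem $$\left\{\begin{array}{ll} u_t+H(\nabla u)=0 & \text{in }(0,T)\times\Omega,\\ u_t+H^-(\nabla u)=0 & \text{on }(0,T)\times\partial\Omega,\end{array}\right.$$ where $H^-$ is the nonincreasing part of $H$ along the inward normal vector.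
   Context: Assumptions on $H$: coercive means $\lim_{|p|\to+\infty}H(p)=+\infty$; quasi-convex means that $\{p: H(p)\le\lambda\}$ is convex for every $\lambda\in\mathbb{R}$. Nonincreasing part. For $x\in\partial\Omega$ let $N_x$ be the inward unit normal. For $p\in\mathbb{R}^{d+1}$ let $p_N=p\cdot N_x\in\mathbb{R}$ and let $p'=p-p_NN_x$ be the tangential component, an element of the tangent hyperplane $N_x^\perp\cong\mathbb{R}^d$; write $p=(p',p_N)$ and $H_x(p',p_N)=H(p'+p_NN_x)$. Let $\pi^0(p')$ be a point with $\min_{p_N\in\mathbb{R}}H_x(p',p_N)=H_x(p',\pi^0(p'))$. Define $H_x^-(p',p_N)=H_x(p',p_N)$ if $p_N\le\pi^0(p')$ and $H_x^-(p',p_N)=H_x(p',\pi^0(p'))$ otherwise. This does not depend on the choice of minimizer. At a boundary point $x$, $H^-$ means $H^-_x$. Envelopes: $u^*(t,x)=\limsup_{(s,y)\to(t,x)}u(s,y)$ and $u_*(t,x)=\liminf_{(s,y)\to(t,x)}u(s,y)$, with $(s,y)\in(0,T)\times\bar\Omega$ (the point $(t,x)$ itself is allowed). Viscosity sense. Test functions are $\varphi\in\mathcal{C}^1((0,T)\times\bar\Omega)$ ($\mathcal C^1$ up to the boundary of $\Omega$). $\varphi$ touches $u^*$ from above (resp. $u_*$ from below) at $(t_0,x_0)\in(0,T)\times\bar\Omega$ if $u^*\le\varphi$ (resp. $u_*\ge\varphi$) in a neighborhood of $(t_0,x_0)$ in $(0,T)\times\bar\Omega$, with equality at $(t_0,x_0)$.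 For $G\in\{H,H^-\}$, "$u_t+G(\nabla u)\le0$ (resp. $\ge 0$) on a set $S\subset(0,T)\times\bar\Omega$" means: for every test function $\varphi$ touching $u^*$ from above (resp. $u_*$ from below) at a point $(t_0,x_0)\in S$, one has $\varphi_t+G(\nabla\varphi)\le 0$ (resp. $\ge0$) at $(t_0,x_0)$. Equality "$=0$" on $S$ means that both inequalities hold on $S$. A viscosity solution of a system satisfies all its lines in this sense. (The weak continuity condition on $u^*$ at the boundary displayed in the claim is also part of the definition of a flux-limited solution.) *)

theory Defs
  imports "HOL-Analysis.Analysis"
begin

definition coercive :: "('a::real_normed_vector \<Rightarrow> real) \<Rightarrow> bool" where
  "coercive H \<longleftrightarrow> filterlim H at_top at_infinity"

definition quasi_convex :: "('a::real_vector \<Rightarrow> real) \<Rightarrow> bool" where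
  "quasi_convex H \<longleftrightarrow> (\<forall>c. convex {p. H p \<le> c})"

text \<open>
  \<open>f\<close> is continuously differentiable on \<open>S\<close> with gradient \<open>g\<close>. The derivative is taken
  within \<open>S\<close>, so if \<open>S\<close> contains boundary points this means \<open>C\<^sup>1\<close> up to the boundary.
\<close>
definition C1_gradient_on ::
  "'a::real_inner set \<Rightarrow> ('a \<Rightarrow> real) \<Rightarrow> ('a \<Rightarrow> 'a) \<Rightarrow> bool" where
  "C1_gradient_on S f g \<longleftrightarrow>
     continuous_on S g \<and> (\<forall>p\<in>S. (f has_derivative (\<lambda>h. g p \<bullet> h)) (at p within S))"

text \<open>For a unit vector \<open>N\<close>: the component of \<open>p\<close> orthogonal to \<open>N\<close>.\<close>
definition tangential :: "'a::real_inner \<Rightarrow> 'a \<Rightarrow> 'a" where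
  "tangential N p = p - (p \<bullet> N) *\<^sub>R N"

text \<open>
  Near \<open>x\<close>, the set \<open>\<Omega>\<close> is the part lying above the graph of a \<open>C\<^sup>1\<close> function \<open>\<gamma>\<close>, in orthonormal
  coordinates whose vertical axis is \<open>e\<close>. Only the values of \<open>\<gamma>\<close> on the hyperplane orthogonal to
  \<open>e\<close> are used; a \<open>C\<^sup>1\<close> function on that hyperplane extends to the whole space as a function
  constant in the direction \<open>e\<close>.
\<close>
definition local_C1_graph ::
  "'a::euclidean_space set \<Rightarrow> 'a \<Rightarrow> 'a \<Rightarrow> ('a \<Rightarrow> real) \<Rightarrow> ('a \<Rightarrow> 'a) \<Rightarrow> real \<Rightarrow> bool" where
  "local_C1_graph \<Omega> x e \<gamma> D\<gamma> r \<longleftrightarrow>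
     norm e = 1 \<and> r > 0 \<and> C1_gradient_on UNIV \<gamma> D\<gamma> \<and>
     \<Omega> \<inter> ball x r = {y \<in> ball x r. y \<bullet> e > \<gamma> (tangential e y)}"

definition C1_boundary :: "'a::euclidean_space set \<Rightarrow> bool" where
  "C1_boundary \<Omega> \<longleftrightarrow> (\<forall>x\<in>frontier \<Omega>. \<exists>e \<gamma> D\<gamma> r. local_C1_graph \<Omega> x e \<gamma> D\<gamma> r)"

text \<open>
  The normalised gradient at \<open>x\<close> of the function \<open>y \<mapsto> y \<bullet> e - \<gamma> (tangential e y)\<close>, which is
  positive exactly on \<open>\<Omega>\<close> near \<open>x\<close>. For \<open>x\<close> in the boundary of an open \<open>\<Omega>\<close>, all local graphs
  give the same vector.
\<close>
definition inward_unit_normal :: "'a::euclidean_space set \<Rightarrow> 'a \<Rightarrow> 'a" where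
  "inward_unit_normal \<Omega> x =
     (SOME N. \<exists>e \<gamma> D\<gamma> r. local_C1_graph \<Omega> x e \<gamma> D\<gamma> r \<and>
        N = sgn (e - tangential e (D\<gamma> (tangential e x))))"

text \<open>
  The point \<open>\<pi>\<^sup>0(p')\<close>, for \<open>p'\<close> orthogonal to \<open>N\<close>. The minimum is attained when \<open>H\<close> is continuous
  and coercive.
\<close>
definition normal_argmin :: "('a::real_inner \<Rightarrow> real) \<Rightarrow> 'a \<Rightarrow> 'a \<Rightarrow> real" where
  "normal_argmin H N p' = arg_min (\<lambda>s. H (p' + s *\<^sub>R N)) (\<lambda>_. True)"

definition nonincreasing_part :: "('a::real_inner \<Rightarrow> real) \<Rightarrow> 'a \<Rightarrow> 'a \<Rightarrow> real" where
  "nonincreasing_part H N p =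
     (let p' = tangential N p; s0 = normal_argmin H N p'
      in if p \<bullet> N \<le> s0 then H p else H (p' + s0 *\<^sub>R N))"

definition locally_bounded_on :: "'b::topological_space set \<Rightarrow> ('b \<Rightarrow> real) \<Rightarrow> bool" where
  "locally_bounded_on S u \<longleftrightarrow>
     (\<forall>p\<in>S. \<exists>V. open V \<and> p \<in> V \<and> bounded (u ` (V \<inter> S)))"

text \<open>
  The filter \<open>inf (nhds p) (principal S)\<close> is \<open>q \<rightarrow> p\<close> with \<open>q \<in> S\<close>, the point \<open>p\<close> itself being
  allowed. The envelopes are extended-real valued; they are finite on \<open>S\<close> if \<open>u\<close> is locally
  bounded on \<open>S\<close>.
\<close>
definition usc_envelope :: "'b::topological_space set \<Rightarrow> ('b \<Rightarrow> real) \<Rightarrow> 'b \<Rightarrow> ereal" where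
  "usc_envelope S u p = Limsup (inf (nhds p) (principal S)) (\<lambda>q. ereal (u q))"

definition lsc_envelope :: "'b::topological_space set \<Rightarrow> ('b \<Rightarrow> real) \<Rightarrow> 'b \<Rightarrow> ereal" where
  "lsc_envelope S u p = Liminf (inf (nhds p) (principal S)) (\<lambda>q. ereal (u q))"

definition touches_from_above ::
  "'b::topological_space set \<Rightarrow> ('b \<Rightarrow> real) \<Rightarrow> ('b \<Rightarrow> ereal) \<Rightarrow> 'b \<Rightarrow> bool" where
  "touches_from_above S \<phi> v p \<longleftrightarrow>
     (\<forall>\<^sub>F q in inf (nhds p) (principal S). v q \<le> ereal (\<phi> q)) \<and> v p = ereal (\<phi> p)"

definition touches_from_below ::
  "'b::topological_space set \<Rightarrow> ('b \<Rightarrow> real) \<Rightarrow> ('b \<Rightarrow> ereal) \<Rightarrow> 'b \<Rightarrow> bool" where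
  "touches_from_below S \<phi> v p \<longleftrightarrow>
     (\<forall>\<^sub>F q in inf (nhds p) (principal S). v q \<ge> ereal (\<phi> q)) \<and> v p = ereal (\<phi> p)"

abbreviation space_time :: "real \<Rightarrow> 'a::euclidean_space set \<Rightarrow> (real \<times> 'a) set" where
  "space_time T \<Omega> \<equiv> {0<..<T} \<times> closure \<Omega>"

text \<open>
  \<open>u\<^sub>t + G(x, \<nabla>u) \<le> 0\<close>, respectively \<open>\<ge> 0\<close>, at the points of \<open>(0,T) \<times> A\<close>, for \<open>A\<close> contained in the
  closure of \<open>\<Omega>\<close>. The two components of the space-time gradient \<open>g\<close> of the test function are its
  time derivative and its spatial gradient.
\<close>
definition viscosity_le ::
  "real \<Rightarrow> 'a::euclidean_space set \<Rightarrow> ('a \<Rightarrow> 'a \<Rightarrow> real) \<Rightarrow> (real \<times> 'a \<Rightarrow> real) \<Rightarrow> 'a set \<Rightarrow> bool" where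
  "viscosity_le T \<Omega> G u A \<longleftrightarrow>
     (\<forall>\<phi> g. C1_gradient_on (space_time T \<Omega>) \<phi> g \<longrightarrow>
       (\<forall>t\<in>{0<..<T}. \<forall>x\<in>A.
          touches_from_above (space_time T \<Omega>) \<phi> (usc_envelope (space_time T \<Omega>) u) (t, x) \<longrightarrow>
          fst (g (t, x)) + G x (snd (g (t, x))) \<le> 0))"

definition viscosity_ge ::
  "real \<Rightarrow> 'a::euclidean_space set \<Rightarrow> ('a \<Rightarrow> 'a \<Rightarrow> real) \<Rightarrow> (real \<times> 'a \<Rightarrow> real) \<Rightarrow> 'a set \<Rightarrow> bool" where
  "viscosity_ge T \<Omega> G u A \<longleftrightarrow>
     (\<forall>\<phi> g. C1_gradient_on (space_time T \<Omega>) \<phi> g \<longrightarrow>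
       (\<forall>t\<in>{0<..<T}. \<forall>x\<in>A.
          touches_from_below (space_time T \<Omega>) \<phi> (lsc_envelope (space_time T \<Omega>) u) (t, x) \<longrightarrow>
          fst (g (t, x)) + G x (snd (g (t, x))) \<ge> 0))"

definition viscosity_eq ::
  "real \<Rightarrow> 'a::euclidean_space set \<Rightarrow> ('a \<Rightarrow> 'a \<Rightarrow> real) \<Rightarrow> (real \<times> 'a \<Rightarrow> real) \<Rightarrow> 'a set \<Rightarrow> bool" where
  "viscosity_eq T \<Omega> G u A \<longleftrightarrow> viscosity_le T \<Omega> G u A \<and> viscosity_ge T \<Omega> G u A"

definition boundary_weakly_continuous ::
  "real \<Rightarrow> 'a::euclidean_space set \<Rightarrow> (real \<times> 'a \<Rightarrow> real) \<Rightarrow> bool" where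
  "boundary_weakly_continuous T \<Omega> u \<longleftrightarrow>
     (\<forall>t\<in>{0<..<T}. \<forall>x\<in>frontier \<Omega>.
        usc_envelope (space_time T \<Omega>) u (t, x) =
        Limsup (inf (nhds (t, x)) (principal ({0<..<T} \<times> \<Omega>))) (usc_envelope (space_time T \<Omega>) u))"

definition state_constraint_solution ::
  "real \<Rightarrow> 'a::euclidean_space set \<Rightarrow> ('a \<Rightarrow> real) \<Rightarrow> (real \<times> 'a \<Rightarrow> real) \<Rightarrow> bool" where
  "state_constraint_solution T \<Omega> H u \<longleftrightarrow>
     viscosity_ge T \<Omega> (\<lambda>x. H) u (closure \<Omega>) \<and>
     viscosity_le T \<Omega> (\<lambda>x. H) u \<Omega>"

text \<open>The weak continuity of the upper envelope at the boundary is part of this notion.\<close>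
definition flux_limited_solution ::
  "real \<Rightarrow> 'a::euclidean_space set \<Rightarrow> ('a \<Rightarrow> real) \<Rightarrow> (real \<times> 'a \<Rightarrow> real) \<Rightarrow> bool" where
  "flux_limited_solution T \<Omega> H u \<longleftrightarrow>
     boundary_weakly_continuous T \<Omega> u \<and>
     viscosity_eq T \<Omega> (\<lambda>x. H) u \<Omega> \<and>
     viscosity_eq T \<Omega> (\<lambda>x. nonincreasing_part H (inward_unit_normal \<Omega> x)) u (frontier \<Omega>)"

end

theory Submission
  imports Defs
begin

text \<open>
  Near a boundary point let \<open>\<psi>\<close> be a \<open>C\<^sup>1\<close> defining function of \<open>\<Omega>\<close>, positive inside, so that
  \<open>\<nabla>\<psi>\<close> points along the inward normal \<open>N\<close>. Quasi-convexity gives \<open>H\<^sup>-(p) \<le> H(p - k N)\<close> for all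
  \<open>k \<ge> 0\<close>, with equality for some \<open>k\<close>. Supersolutions: if \<open>\<phi>\<close> touches from below, so does
  \<open>\<phi> - k \<psi>\<close>, and the right \<open>k\<close> turns \<open>H\<close> into \<open>H\<^sup>-\<close>. Subsolutions: if \<open>\<phi>\<^sub>t + H\<^sup>-(\<nabla>\<phi>) > 0\<close> at a
  boundary contact point \<open>z\<^sub>0\<close>, then by coercivity \<open>\<tau> + H(p - k \<nabla>\<psi>) > 0\<close> uniformly in \<open>k \<ge> 0\<close> near
  \<open>z\<^sub>0\<close>. The test function \<open>\<phi> + |z - z\<^sub>0|\<^sup>2 + \<epsilon> exp(- k \<psi>)\<close> costs the full \<open>\<epsilon>\<close> on the boundary and,
  for large \<open>k\<close>, almost nothing at an interior point where \<open>u\<^sup>*\<close> is nearly \<open>u\<^sup>*(z\<^sub>0)\<close>; such points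
  exist by weak continuity. Hence \<open>u\<^sup>*\<close> is touched at an interior point, where the subsolution
  inequality fails.
\<close>


section \<open>Limits within a set and maxima of semicontinuous functions\<close>

lemma eventually_nhds_within_metric:
  fixes p :: "'b::metric_space"
  shows "eventually P (inf (nhds p) (principal S)) \<longleftrightarrow>
    (\<exists>d>0. \<forall>q\<in>S. dist q p < d \<longrightarrow> P q)"
  by (auto simp: eventually_inf_principal eventually_nhds_metric)

lemma continuous_on_tendsto_nhds_within:
  assumes "continuous_on S f" "p \<in> S"
  shows "(f \<longlongrightarrow> f p) (inf (nhds p) (principal S))"
  unfolding tendsto_def eventually_inf_principal eventually_nhds
  using assms unfolding continuous_on_topological by metis

text \<open>Without a maximum, every \<open>x\<close> has some \<open>y x\<close> with a larger
  value, and semicontinuity gives an open \<open>V x\<close> on which \<open>f\<close> stays below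
  \<open>f (y x)\<close>. Take a finite subcover and the best of its finitely many points
  \<open>y x\<close>: it lies in some \<open>V x\<close> itself, so another of these points beats
  it.\<close>

lemma usc_attains_max:
  fixes f :: "'b::topological_space \<Rightarrow> 'c::linorder"
  assumes "compact K" "K \<noteq> {}"
    and usc: "\<And>x c. x \<in> K \<Longrightarrow> f x < c \<Longrightarrow> \<forall>\<^sub>F y in inf (nhds x) (principal K). f y < c"
  obtains x where "x \<in> K" "\<And>y. y \<in> K \<Longrightarrow> f y \<le> f x"
proof -
  have "\<exists>x\<in>K. \<forall>y\<in>K. f y \<le> f x"
  proof (rule ccontr)
    assume no_max: "\<not> ?thesis"
    have "\<exists>y V. y \<in> K \<and> open V \<and> x \<in> V \<and> (\<forall>z\<in>V \<inter> K. f z < f y)" if "x \<in> K" for x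
    proof -
      obtain y where y: "y \<in> K" "f x < f y" using no_max \<open>x \<in> K\<close> by (meson not_le)
      with usc[OF that y(2)] show ?thesis
        unfolding eventually_inf_principal eventually_nhds by blast
    qed
    then obtain y V where yV: "\<And>x. x \<in> K \<Longrightarrow> y x \<in> K \<and> open (V x) \<and> x \<in> V x \<and> (\<forall>z\<in>V x \<inter> K. f z < f (y x))"
      by metis
    obtain D where D: "D \<subseteq> K" "finite D" "K \<subseteq> (\<Union>x\<in>D. V x)"
      using compactE_image[OF \<open>compact K\<close>, of K V] yV by blast
    then have "D \<noteq> {}" using \<open>K \<noteq> {}\<close> by auto
    then have "Max ((\<lambda>x. f (y x)) ` D) \<in> (\<lambda>x. f (y x)) ` D"
      using D(2) by (intro Max_in) auto
    then obtain m where m: "m \<in> D" "f (y m) = Max ((\<lambda>x. f (y x)) ` D)" by force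
    then have max: "f (y x) \<le> f (y m)" if "x \<in> D" for x
      using D(2) that by simp
    obtain x where "x \<in> D" "y m \<in> V x" using D m yV by blast
    then have "f (y m) < f (y x)" using yV D m(1) by blast
    with max[OF \<open>x \<in> D\<close>] show False by simp
  qed
  then show thesis using that by blast
qed

section \<open>Calculus of test functions\<close>

lemma C1_gradient_on_continuous_on:
  "C1_gradient_on S f g \<Longrightarrow> continuous_on S f"
  unfolding C1_gradient_on_def
  by (meson continuous_on_eq_continuous_within has_derivative_continuous)

lemma C1_gradient_on_add:
  assumes "C1_gradient_on S f1 g1" "C1_gradient_on S f2 g2"
  shows "C1_gradient_on S (\<lambda>p. f1 p + f2 p) (\<lambda>p. g1 p + g2 p)"
  using assms unfolding C1_gradient_on_def
  by (auto intro!: continuous_intros derivative_eq_intros simp: inner_add_left)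

lemma C1_gradient_on_compose:
  assumes "C1_gradient_on S f g" "\<And>s. (h has_real_derivative h' s) (at s)" "continuous_on UNIV h'"
  shows "C1_gradient_on S (\<lambda>p. h (f p)) (\<lambda>p. h' (f p) *\<^sub>R g p)"
  unfolding C1_gradient_on_def
proof (intro conjI ballI)
  show "continuous_on S (\<lambda>p. h' (f p) *\<^sub>R g p)"
    using assms(1) C1_gradient_on_continuous_on[OF assms(1)]
    by (auto intro!: continuous_intros continuous_on_compose2[OF assms(3)] simp: C1_gradient_on_def)
  show "((\<lambda>p. h (f p)) has_derivative (\<lambda>v. (h' (f p) *\<^sub>R g p) \<bullet> v)) (at p within S)"
    if "p \<in> S" for p
  proof -
    have f: "(f has_derivative (\<lambda>v. g p \<bullet> v)) (at p within S)"
      using assms(1) that by (simp add: C1_gradient_on_def)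
    show ?thesis
      using has_derivative_compose[OF f assms(2)[of "f p", unfolded has_field_derivative_def]]
      by (simp add: o_def)
  qed
qed

lemma C1_gradient_on_sq_norm:
  "C1_gradient_on S (\<lambda>p. (norm (p - a))\<^sup>2) (\<lambda>p. 2 *\<^sub>R (p - a))"
  unfolding C1_gradient_on_def power2_norm_eq_inner
  by (auto intro!: continuous_intros derivative_eq_intros simp: inner_commute)

lemma C1_gradient_on_snd:
  assumes "C1_gradient_on UNIV \<psi> w"
  shows "C1_gradient_on S (\<lambda>z. \<psi> (snd z)) (\<lambda>z. (0, w (snd z)))"
  unfolding C1_gradient_on_def
proof (intro conjI ballI)
  show "continuous_on S (\<lambda>z. (0, w (snd z)))"
    using assms
    by (auto intro!: continuous_intros continuous_on_compose2[of UNIV w] simp: C1_gradient_on_def)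
  show "((\<lambda>z. \<psi> (snd z)) has_derivative (\<lambda>h. (0, w (snd z)) \<bullet> h)) (at z within S)" for z
  proof -
    have "(\<psi> has_derivative (\<lambda>v. w (snd z) \<bullet> v)) (at (snd z))"
      using assms by (simp add: C1_gradient_on_def)
    from has_derivative_compose[OF has_derivative_snd[OF has_derivative_ident] this]
    show ?thesis by (simp add: inner_prod_def)
  qed
qed

section \<open>Defining functions of a domain with \<open>C1_boundary\<close>\<close>

lemma tangential_inner_commute: "tangential N p \<bullet> q = p \<bullet> tangential N q"
  by (simp add: tangential_def algebra_simps inner_commute)

lemma tangential_orthogonal: "norm N = 1 \<Longrightarrow> tangential N p \<bullet> N = 0"
  by (simp add: tangential_def algebra_simps norm_eq_1)

text \<open>The function is the height above the graph,
  \<open>y \<bullet> e - \<gamma> (tangential e y)\<close>. The graph is the very one behind the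
  choice in \<open>inward_unit_normal\<close>, obtained through \<open>someI_ex\<close>, so the
  normal is \<open>sgn (w x)\<close> by construction.\<close>

lemma defining_function:
  fixes \<Omega> :: "'a::euclidean_space set"
  assumes "open \<Omega>" "C1_boundary \<Omega>" "x \<in> frontier \<Omega>"
  obtains \<psi> w r where "C1_gradient_on UNIV \<psi> w" "r > 0" "w x \<noteq> 0"
    "inward_unit_normal \<Omega> x = sgn (w x)" "\<psi> x = 0"
    "\<And>y. y \<in> ball x r \<Longrightarrow> y \<in> \<Omega> \<longleftrightarrow> \<psi> y > 0"
    "\<And>y. y \<in> ball x r \<Longrightarrow> y \<in> closure \<Omega> \<Longrightarrow> \<psi> y \<ge> 0"
proof -
  have "\<exists>N e \<gamma> D\<gamma> r. local_C1_graph \<Omega> x e \<gamma> D\<gamma> r \<and>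
        N = sgn (e - tangential e (D\<gamma> (tangential e x)))"
    using assms unfolding C1_boundary_def by blast
  from someI_ex[OF this] obtain e \<gamma> D\<gamma> r where
    graph: "local_C1_graph \<Omega> x e \<gamma> D\<gamma> r" and
    N: "inward_unit_normal \<Omega> x = sgn (e - tangential e (D\<gamma> (tangential e x)))"
    unfolding inward_unit_normal_def by blast
  have e: "norm e = 1" and "r > 0" and \<gamma>: "C1_gradient_on UNIV \<gamma> D\<gamma>"
    and above: "\<Omega> \<inter> ball x r = {y \<in> ball x r. y \<bullet> e > \<gamma> (tangential e y)}"
    using graph by (auto simp: local_C1_graph_def)
  define \<psi> where "\<psi> y = y \<bullet> e - \<gamma> (tangential e y)" for y
  define w where "w y = e - tangential e (D\<gamma> (tangential e y))" for y
  have tang: "continuous_on A (\<lambda>y. tangential e y)" for A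
    unfolding tangential_def by (intro continuous_intros)
  have C1: "C1_gradient_on UNIV \<psi> w"
    unfolding C1_gradient_on_def
  proof (intro conjI ballI)
    have "continuous_on UNIV (\<lambda>y. D\<gamma> (tangential e y))"
      using \<gamma> by (intro continuous_on_compose2[OF _ tang]) (auto simp: C1_gradient_on_def)
    then have "continuous_on UNIV (\<lambda>y. tangential e (D\<gamma> (tangential e y)))"
      by (intro continuous_on_compose2[OF tang[of UNIV]]) auto
    then show "continuous_on UNIV w"
      unfolding w_def by (intro continuous_intros)
    fix y
    have "(tangential e has_derivative tangential e) (at y)"
      unfolding tangential_def[abs_def] by (auto intro!: derivative_eq_intros)
    moreover have "(\<gamma> has_derivative (\<lambda>h. D\<gamma> (tangential e y) \<bullet> h)) (at (tangential e y))"
      using \<gamma> by (simp add: C1_gradient_on_def)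
    ultimately have "((\<lambda>y. \<gamma> (tangential e y)) has_derivative
        (\<lambda>h. D\<gamma> (tangential e y) \<bullet> tangential e h)) (at y)"
      by (rule has_derivative_compose)
    then show "(\<psi> has_derivative (\<lambda>h. w y \<bullet> h)) (at y)"
      unfolding \<psi>_def[abs_def] w_def
      by (auto intro!: derivative_eq_intros
          simp: inner_diff_right tangential_inner_commute inner_commute)
  qed
  have cont: "continuous_on UNIV \<psi>"
    using C1 by (rule C1_gradient_on_continuous_on)
  have iff: "y \<in> \<Omega> \<longleftrightarrow> \<psi> y > 0" if "y \<in> ball x r" for y
    using that eqset_imp_iff[OF above, of y] unfolding \<psi>_def by (simp del: mem_ball)
  \<comment> \<open>The part of the ball where \<open>\<psi>\<close> is negative is open and misses
    \<open>\<Omega>\<close>, hence it misses the closure too.\<close>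
  have ge: "\<psi> y \<ge> 0" if y: "y \<in> ball x r" "y \<in> closure \<Omega>" for y
  proof (rule ccontr)
    assume "\<not> \<psi> y \<ge> 0"
    then have "y \<in> ball x r \<inter> \<psi> -` {..<0}" using y by simp
    moreover have "open (ball x r \<inter> \<psi> -` {..<0})"
      using cont by (intro open_Int open_vimage) auto
    ultimately obtain z where "z \<in> \<Omega>" "z \<in> ball x r" "\<psi> z < 0"
      using y(2) open_Int_closure_eq_empty[of "ball x r \<inter> \<psi> -` {..<0}" \<Omega>] by auto
    with iff[of z] show False by simp
  qed
  have "x \<in> closure \<Omega>" "x \<notin> \<Omega>"
    using assms by (auto simp: frontier_def interior_open)
  then have "\<psi> x = 0" using ge[of x] iff[of x] \<open>r > 0\<close> by force
  \<comment> \<open>The tangential term of \<open>w x\<close> is orthogonal to \<open>e\<close>, so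
    only \<open>e \<bullet> e\<close> remains.\<close>
  have "w x \<bullet> e = 1"
    using e tangential_orthogonal[OF e] by (simp add: w_def inner_diff_left norm_eq_1)
  then have "w x \<noteq> 0" by auto
  then show thesis
    using that[OF C1 \<open>r > 0\<close>] N \<open>\<psi> x = 0\<close> iff ge by (simp add: w_def)
qed

section \<open>Coercivity and the nonincreasing part of the Hamiltonian\<close>

lemma coercive_lower_bound:
  assumes "coercive H"
  obtains R where "R > 0" "\<And>q. norm q \<ge> R \<Longrightarrow> H q > c"
proof -
  have "\<forall>\<^sub>F q in at_infinity. H q > c"
    using assms unfolding coercive_def filterlim_at_top_dense by blast
  then obtain b where "\<And>q. norm q \<ge> b \<Longrightarrow> H q > c"
    by (auto simp: eventually_at_infinity)
  then show thesis using that[of "max b 1"] by simp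
qed

text \<open>By coercivity \<open>H\<close> exceeds its value at \<open>s = 0\<close> outside a
  compact interval around 0, so a minimum over that interval is global and \<open>arg_min\<close>
  denotes a true minimizer.\<close>

lemma normal_argmin_le:
  fixes H :: "'a::euclidean_space \<Rightarrow> real"
  assumes "continuous_on UNIV H" "coercive H" "norm N = 1"
  shows "H (p' + normal_argmin H N p' *\<^sub>R N) \<le> H (p' + s *\<^sub>R N)"
proof -
  define h where "h s = H (p' + s *\<^sub>R N)" for s
  obtain R where R: "R > 0" "\<And>q. norm q \<ge> R \<Longrightarrow> H q > H p'"
    using coercive_lower_bound[OF assms(2)] by metis
  define B where "B = R + norm p'"
  have "continuous_on {-B..B} h"
    unfolding h_def by (intro continuous_on_compose2[OF assms(1)] continuous_intros) auto
  moreover have zero: "0 \<in> {-B..B}" using R(1) norm_ge_zero[of p'] unfolding B_def atLeastAtMost_iff by linarith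
  ultimately obtain m where m: "\<And>s. s \<in> {-B..B} \<Longrightarrow> h m \<le> h s"
    using continuous_attains_inf[of "{-B..B}" h] by (metis compact_Icc empty_iff)
  have "h m \<le> h s" for s
  proof (cases "s \<in> {-B..B}")
    case False
    then have "R + norm p' \<le> norm (s *\<^sub>R N)" using assms(3) by (auto simp: B_def)
    also have "\<dots> \<le> norm (p' + s *\<^sub>R N) + norm p'"
      by (metis add_diff_cancel_left' norm_triangle_ineq4)
    finally have "h 0 < h s" using R(2) by (simp add: h_def)
    with m[OF zero] show ?thesis by simp
  qed (use m in auto)
  then have "h (arg_min h (\<lambda>_. True)) = h m"
    by (intro arg_min_equality) auto
  with \<open>h m \<le> h s\<close> show ?thesis
    by (simp add: normal_argmin_def h_def[abs_def])
qed

lemma tangential_plus_normal: "tangential N p + (p \<bullet> N) *\<^sub>R N = p"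
  by (simp add: tangential_def)

text \<open>If \<open>p\<close> lies before the minimizer on its normal line, then \<open>p\<close>
  is on the segment from \<open>p - k *\<^sub>R N\<close> to the minimizer; both ends belong to the
  sublevel set of \<open>H (p - k *\<^sub>R N)\<close>, which is convex. Past the minimizer, the
  left side is the minimum over the line.\<close>

lemma nonincreasing_part_le:
  fixes H :: "'a::euclidean_space \<Rightarrow> real"
  assumes "continuous_on UNIV H" "coercive H" "quasi_convex H" "norm N = 1" "k \<ge> 0"
  shows "nonincreasing_part H N p \<le> H (p - k *\<^sub>R N)"
proof -
  define p' where "p' = tangential N p"
  define s0 where "s0 = normal_argmin H N p'"
  define c where "c = p \<bullet> N"
  note min = normal_argmin_le[OF assms(1,2,4), of p', folded s0_def]
  have p: "p = p' + c *\<^sub>R N" by (simp add: p'_def c_def tangential_plus_normal)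
  have pk: "p - k *\<^sub>R N = p' + (c - k) *\<^sub>R N" by (simp add: p algebra_simps)
  show ?thesis
  proof (cases "c \<le> s0")
    case True
    then have eq: "nonincreasing_part H N p = H p"
      by (simp add: nonincreasing_part_def p'_def s0_def c_def Let_def)
    have conv: "convex {q. H q \<le> H (p - k *\<^sub>R N)}"
      using assms(3) by (simp add: quasi_convex_def)
    show ?thesis
    proof (cases "k = 0")
      case False
      with \<open>k \<ge> 0\<close> True have pos: "s0 - (c - k) > 0" by simp
      \<comment> \<open>The segment has length \<open>s0 - (c - k)\<close> and \<open>p\<close> is
        at distance \<open>k\<close> from its start, so \<open>l\<close> is the weight of the
        minimizer.\<close>
      define l where "l = k / (s0 - (c - k))"
      have l: "0 \<le> l" "l \<le> 1" using \<open>k \<ge> 0\<close> True pos by (auto simp: l_def)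
      have "l * (s0 - (c - k)) = k" using pos by (simp add: l_def)
      then have "c = (1 - l) * (c - k) + l * s0" by (simp add: algebra_simps)
      then have "c *\<^sub>R N = ((1 - l) * (c - k)) *\<^sub>R N + (l * s0) *\<^sub>R N"
        by (metis scaleR_add_left)
      moreover have "p' = (1 - l) *\<^sub>R p' + l *\<^sub>R p'"
        by (simp add: scaleR_left_diff_distrib)
      ultimately have "p = (1 - l) *\<^sub>R (p' + (c - k) *\<^sub>R N) + l *\<^sub>R (p' + s0 *\<^sub>R N)"
        unfolding p by (simp add: scaleR_add_right)
      then show ?thesis
        using convexD[OF conv, of "p' + (c - k) *\<^sub>R N" "p' + s0 *\<^sub>R N" "1 - l" l] l min eq
        unfolding pk by auto
    qed (simp add: eq)
  next
    case False
    then have "nonincreasing_part H N p = H (p' + s0 *\<^sub>R N)"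
      by (simp add: nonincreasing_part_def p'_def s0_def c_def Let_def)
    with min pk show ?thesis by simp
  qed
qed

text \<open>Either \<open>k = 0\<close>, or \<open>k\<close> is the distance from \<open>p\<close>
  back to the minimizer.\<close>

lemma nonincreasing_part_attained:
  assumes "norm N = 1"
  obtains k where "k \<ge> 0" "nonincreasing_part H N p = H (p - k *\<^sub>R N)"
proof (cases "p \<bullet> N \<le> normal_argmin H N (tangential N p)")
  case True
  then show thesis using that[of 0] by (simp add: nonincreasing_part_def Let_def)
next
  case False
  then show thesis
    using that[of "p \<bullet> N - normal_argmin H N (tangential N p)"]
    by (simp add: nonincreasing_part_def Let_def tangential_def algebra_simps)
qed

text \<open>Here \<open>z\<close> pairs a time derivative with a spatial gradient. The parameter
  \<open>k\<close> ranges over an unbounded set, so it is split at a threshold \<open>K\<close>: up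
  to \<open>K\<close> the tube lemma over a compact interval gives a uniform neighbourhood, and
  beyond \<open>K\<close> coercivity gives positivity.\<close>

lemma ray_positivity_stable:
  fixes H :: "'a::euclidean_space \<Rightarrow> real"
  assumes H: "continuous_on UNIV H" "coercive H" and "w \<noteq> 0"
    and pos: "\<And>k. k \<ge> 0 \<Longrightarrow> fst z + H (snd z - k *\<^sub>R w) > 0"
  shows "\<forall>\<^sub>F q in nhds (z, w). \<forall>k\<ge>0. fst (fst q) + H (snd (fst q) - k *\<^sub>R snd q) > 0"
proof -
  \<comment> \<open>The extra 1 absorbs the variation of the time derivative, which stays above
    \<open>fst z - 1\<close> nearby.\<close>
  obtain R where R: "R > 0" "\<And>q. norm q \<ge> R \<Longrightarrow> H q > 1 - fst z"
    using coercive_lower_bound[OF H(2)] by metis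
  \<comment> \<open>Close to \<open>(z, w)\<close> the direction has norm above
    \<open>norm w / 2\<close> and the gradient has norm below \<open>norm (snd z) + 1\<close>; then
    \<open>k \<ge> K\<close> pushes the argument of \<open>H\<close> to norm at least
    \<open>R\<close>.\<close>
  define K where "K = (R + norm (snd z) + 1) / (norm w / 2)"
  define F where "F q = fst (fst (fst q)) + H (snd (fst (fst q)) - snd q *\<^sub>R snd (fst q))"
    for q :: "((real \<times> 'a) \<times> 'a) \<times> real"
  have "continuous_on UNIV F"
    unfolding F_def by (intro continuous_intros continuous_on_compose2[OF H(1)]) auto
  then have "open (F -` {0<..})" by (intro open_vimage) auto
  moreover have "{(z, w)} \<times> {0..K} \<subseteq> F -` {0<..}"
    using pos by (auto simp: F_def)
  ultimately obtain X where X: "(z, w) \<in> X" "open X" "X \<times> {0..K} \<subseteq> F -` {0<..}"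
    using Elementary_Topology.tube_lemma[of "{0..K}" "F -` {0<..}" "(z, w)"] by auto
  have "((\<lambda>q. fst (fst q)) \<longlongrightarrow> fst z) (nhds (z, w))"
    by (auto intro!: tendsto_eq_intros filterlim_ident)
  then have "\<forall>\<^sub>F q in nhds (z, w). fst (fst q) > fst z - 1"
    by (rule order_tendstoD) simp
  moreover have "((\<lambda>q. norm (snd (fst q))) \<longlongrightarrow> norm (snd z)) (nhds (z, w))"
    by (auto intro!: tendsto_eq_intros filterlim_ident)
  then have "\<forall>\<^sub>F q in nhds (z, w). norm (snd (fst q)) < norm (snd z) + 1"
    by (rule order_tendstoD) simp
  moreover have "((\<lambda>q. norm (snd q)) \<longlongrightarrow> norm w) (nhds (z, w))"
    by (auto intro!: tendsto_eq_intros filterlim_ident)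
  then have "\<forall>\<^sub>F q in nhds (z, w). norm (snd q) > norm w / 2"
    by (rule order_tendstoD) (use \<open>w \<noteq> 0\<close> in simp)
  moreover have "\<forall>\<^sub>F q in nhds (z, w). q \<in> X"
    using X by (intro eventually_nhds_in_open)
  ultimately show ?thesis
  proof eventually_elim
    case (elim q)
    show ?case
    proof (intro allI impI)
      fix k :: real
      assume "k \<ge> 0"
      show "fst (fst q) + H (snd (fst q) - k *\<^sub>R snd q) > 0"
      proof (cases "k \<le> K")
        case True
        then have "(q, k) \<in> F -` {0<..}"
          using elim \<open>k \<ge> 0\<close> by (intro subsetD[OF X(3)]) auto
        then show ?thesis by (simp add: F_def)
      next
        case False
        have "R + norm (snd z) + 1 = K * (norm w / 2)"
          using \<open>w \<noteq> 0\<close> by (simp add: K_def)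
        also have "\<dots> \<le> k * norm (snd q)"
          using False \<open>k \<ge> 0\<close> elim(3) by (intro mult_mono) auto
        also have "\<dots> = norm (k *\<^sub>R snd q)" using \<open>k \<ge> 0\<close> by simp
        also have "\<dots> \<le> norm (snd (fst q) - k *\<^sub>R snd q) + norm (snd (fst q))"
          by (metis norm_minus_commute norm_triangle_sub add.commute)
        finally have "R \<le> norm (snd (fst q) - k *\<^sub>R snd q)" using elim(2) by simp
        from R(2)[OF this] elim(1) show ?thesis by simp
      qed
    qed
  qed
qed

section \<open>Semicontinuity and finiteness of the upper envelope\<close>

text \<open>A bound on \<open>u\<close> over an open set bounds the envelope at each point of that
  set. Only the weak inequality survives the \<open>Limsup\<close>, hence the intermediate level
  \<open>c'\<close>.\<close>

lemma usc_envelope_upper_semicontinuous: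
  assumes "usc_envelope S u p < c"
  shows "\<forall>\<^sub>F q in inf (nhds p) (principal S). usc_envelope S u q < c"
proof -
  obtain c' where c': "usc_envelope S u p < c'" "c' < c" using assms dense by blast
  have "\<forall>\<^sub>F q in inf (nhds p) (principal S). ereal (u q) < c'"
    using c'(1) unfolding usc_envelope_def by (rule Limsup_lessD)
  then obtain V where V: "open V" "p \<in> V" "\<And>q. q \<in> V \<Longrightarrow> q \<in> S \<Longrightarrow> ereal (u q) < c'"
    unfolding eventually_inf_principal eventually_nhds by auto
  have "usc_envelope S u q < c" if "q \<in> V" for q
  proof -
    have "usc_envelope S u q \<le> c'"
      unfolding usc_envelope_def
    proof (rule Limsup_bounded)
      show "\<forall>\<^sub>F r in inf (nhds q) (principal S). ereal (u r) \<le> c'"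
        unfolding eventually_inf_principal eventually_nhds using V that by (meson less_imp_le)
    qed
    with c' show ?thesis by simp
  qed
  then show ?thesis
    unfolding eventually_inf_principal eventually_nhds using V by blast
qed

lemma usc_envelope_finite:
  assumes "locally_bounded_on S u" "p \<in> S"
  shows "\<bar>usc_envelope S u p\<bar> \<noteq> \<infinity>"
proof -
  obtain V where V: "open V" "p \<in> V" "bounded (u ` (V \<inter> S))"
    using assms by (auto simp: locally_bounded_on_def)
  then obtain B where B: "\<And>q. q \<in> V \<Longrightarrow> q \<in> S \<Longrightarrow> \<bar>u q\<bar> \<le> B"
    by (auto simp: bounded_iff)
  have ev: "\<forall>\<^sub>F q in inf (nhds p) (principal S). \<bar>u q\<bar> \<le> B"
    unfolding eventually_inf_principal eventually_nhds using V B by blast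
  have ne: "inf (nhds p) (principal S) \<noteq> bot"
    unfolding trivial_limit_def eventually_inf_principal
    using assms(2) eventually_nhds_x_imp_x by force
  have "usc_envelope S u p \<le> ereal B"
    unfolding usc_envelope_def
    by (rule Limsup_bounded) (use ev in \<open>auto elim!: eventually_mono\<close>)
  moreover have "ereal (- B) \<le> usc_envelope S u p"
    unfolding usc_envelope_def
    by (rule le_Limsup[OF ne]) (use ev in \<open>auto elim!: eventually_mono\<close>)
  ultimately show ?thesis by auto
qed


section \<open>Supersolutions at the boundary\<close>

lemma boundary_supersolution:
  fixes \<Omega> :: "'a::euclidean_space set"
  assumes "open \<Omega>" "C1_boundary \<Omega>" and super: "viscosity_ge T \<Omega> (\<lambda>x. H) u (closure \<Omega>)"
  shows "viscosity_ge T \<Omega> (\<lambda>x. nonincreasing_part H (inward_unit_normal \<Omega> x)) u (frontier \<Omega>)"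
  unfolding viscosity_ge_def
proof (intro allI impI ballI)
  fix \<phi> g t x
  assume C1: "C1_gradient_on (space_time T \<Omega>) \<phi> g" and t: "t \<in> {0<..<T}" and x: "x \<in> frontier \<Omega>"
    and touch: "touches_from_below (space_time T \<Omega>) \<phi> (lsc_envelope (space_time T \<Omega>) u) (t, x)"
  obtain \<psi> w r where \<psi>: "C1_gradient_on UNIV \<psi> w" "r > 0" "w x \<noteq> 0"
    "inward_unit_normal \<Omega> x = sgn (w x)" "\<psi> x = 0"
    "\<And>y. y \<in> ball x r \<Longrightarrow> y \<in> closure \<Omega> \<Longrightarrow> \<psi> y \<ge> 0"
    using defining_function[OF assms(1,2) x] by metis
  define N where "N = inward_unit_normal \<Omega> x"
  have "norm N = 1" using \<psi>(3,4) by (simp add: N_def norm_sgn)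
  then obtain k0 where k0: "k0 \<ge> 0" "nonincreasing_part H N (snd (g (t, x))) = H (snd (g (t, x)) - k0 *\<^sub>R N)"
    using nonincreasing_part_attained by metis
  \<comment> \<open>Rescaled because \<open>\<nabla>\<psi>\<close> at \<open>x\<close> is
    \<open>w x\<close>, a positive multiple of the unit normal.\<close>
  define k where "k = k0 / norm (w x)"
  have k: "k \<ge> 0" "k *\<^sub>R w x = k0 *\<^sub>R N"
    using k0 \<psi>(3,4) by (auto simp: k_def N_def sgn_div_norm divide_inverse)
  have "C1_gradient_on (space_time T \<Omega>) (\<lambda>z. (- k) * \<psi> (snd z)) (\<lambda>z. (- k) *\<^sub>R (0, w (snd z)))"
    by (rule C1_gradient_on_compose[OF C1_gradient_on_snd[OF \<psi>(1)], where h="\<lambda>s. (- k) * s" and h'="\<lambda>_. - k"])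
      (auto intro!: derivative_eq_intros)
  from C1_gradient_on_add[OF C1 this]
  have C1': "C1_gradient_on (space_time T \<Omega>) (\<lambda>z. \<phi> z + (- k) * \<psi> (snd z)) (\<lambda>z. g z + (- k) *\<^sub>R (0, w (snd z)))" .
  have "\<forall>\<^sub>F z in inf (nhds (t, x)) (principal (space_time T \<Omega>)). snd z \<in> ball x r \<and> z \<in> space_time T \<Omega>"
  proof -
    have "\<forall>\<^sub>F z in nhds (t, x). z \<in> UNIV \<times> ball x r"
      using \<psi>(2) by (intro eventually_nhds_in_open) (auto intro!: open_Times)
    then show ?thesis
      unfolding eventually_inf_principal by (auto elim!: eventually_mono)
  qed
  moreover have "\<forall>\<^sub>F z in inf (nhds (t, x)) (principal (space_time T \<Omega>)).
      ereal (\<phi> z) \<le> lsc_envelope (space_time T \<Omega>) u z"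
    using touch by (simp add: touches_from_below_def)
  ultimately have "\<forall>\<^sub>F z in inf (nhds (t, x)) (principal (space_time T \<Omega>)).
      ereal (\<phi> z + (- k) * \<psi> (snd z)) \<le> lsc_envelope (space_time T \<Omega>) u z"
  proof eventually_elim
    case (elim z)
    then have "\<psi> (snd z) \<ge> 0" using \<psi>(6) by auto
    then have "ereal (\<phi> z + (- k) * \<psi> (snd z)) \<le> ereal (\<phi> z)" using k(1) by simp
    with elim show ?case using order_trans by blast
  qed
  \<comment> \<open>Equality at the contact point survives because
    \<open>\<psi> x = 0\<close>.\<close>
  then have "touches_from_below (space_time T \<Omega>) (\<lambda>z. \<phi> z + (- k) * \<psi> (snd z))
      (lsc_envelope (space_time T \<Omega>) u) (t, x)"
    using touch \<psi>(5) by (simp add: touches_from_below_def)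
  moreover have "x \<in> closure \<Omega>" using x by (simp add: frontier_def)
  ultimately have "fst (g (t, x) + (- k) *\<^sub>R (0, w (snd (t, x)))) +
      H (snd (g (t, x) + (- k) *\<^sub>R (0, w (snd (t, x))))) \<ge> 0"
    using super C1' t unfolding viscosity_ge_def by blast
  then show "0 \<le> fst (g (t, x)) + nonincreasing_part H (inward_unit_normal \<Omega> x) (snd (g (t, x)))"
    using k0 k by (simp flip: N_def)
qed

section \<open>Subsolutions at the boundary\<close>

text \<open>The perturbed difference is maximized over a compact piece \<open>K\<close> of
  space-time. The exponential term keeps the maximizer off the boundary of \<open>\<Omega>\<close>,
  the quadratic term keeps it off the sphere, and the value at \<open>z1\<close> makes the maximum
  large enough for both.\<close>

lemma boundary_subsolution:
  fixes \<Omega> :: "'a::euclidean_space set"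
  assumes "open \<Omega>" "bounded \<Omega>" "C1_boundary \<Omega>"
    and H: "continuous_on UNIV H" "coercive H" "quasi_convex H"
    and lb: "locally_bounded_on (space_time T \<Omega>) u"
    and weak: "boundary_weakly_continuous T \<Omega> u"
    and sub: "viscosity_le T \<Omega> (\<lambda>x. H) u \<Omega>"
  shows "viscosity_le T \<Omega> (\<lambda>x. nonincreasing_part H (inward_unit_normal \<Omega> x)) u (frontier \<Omega>)"
  unfolding viscosity_le_def
proof (intro allI impI ballI, rule ccontr)
  fix \<phi> g t x
  assume C1: "C1_gradient_on (space_time T \<Omega>) \<phi> g" and t: "t \<in> {0<..<T}" and x: "x \<in> frontier \<Omega>"
    and touch: "touches_from_above (space_time T \<Omega>) \<phi> (usc_envelope (space_time T \<Omega>) u) (t, x)"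
    and contra: "\<not> fst (g (t, x)) + nonincreasing_part H (inward_unit_normal \<Omega> x) (snd (g (t, x))) \<le> 0"
  define S where "S = space_time T \<Omega>"
  define z0 where "z0 = (t, x)"
  define us where "us = usc_envelope S u"
  define v where "v z = real_of_ereal (us z)" for z
  have us: "us z = ereal (v z)" if "z \<in> S" for z
    using usc_envelope_finite[OF lb[folded S_def] that] by (simp add: v_def us_def ereal_real)
  have "x \<in> closure \<Omega>" using x by (simp add: frontier_def)
  with t have z0: "z0 \<in> S" by (simp add: S_def z0_def)
  have v0: "v z0 = \<phi> z0"
    using touch us[OF z0] by (simp add: touches_from_above_def us_def S_def z0_def)
  obtain \<psi> w r where \<psi>: "C1_gradient_on UNIV \<psi> w" "r > 0" "w x \<noteq> 0"
    "inward_unit_normal \<Omega> x = sgn (w x)"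
    and inside: "\<And>y. y \<in> ball x r \<Longrightarrow> y \<in> \<Omega> \<longleftrightarrow> \<psi> y > 0"
    and nonneg: "\<And>y. y \<in> ball x r \<Longrightarrow> y \<in> closure \<Omega> \<Longrightarrow> \<psi> y \<ge> 0"
    using defining_function[OF assms(1,3) x] by metis
  \<comment> \<open>The square makes the contact strict and leaves the gradient at \<open>z0\<close>
    unchanged.\<close>
  define \<phi>1 where "\<phi>1 z = \<phi> z + (norm (z - z0))\<^sup>2" for z
  define g1 where "g1 z = g z + 2 *\<^sub>R (z - z0)" for z
  have C1': "C1_gradient_on S \<phi>1 g1"
    unfolding \<phi>1_def g1_def using C1_gradient_on_add[OF C1 C1_gradient_on_sq_norm] by (simp add: S_def)

  have pos: "fst (g1 z0) + H (snd (g1 z0) - k *\<^sub>R w x) > 0" if "k \<ge> 0" for k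
  proof -
    have "nonincreasing_part H (sgn (w x)) (snd (g z0)) \<le> H (snd (g z0) - (k * norm (w x)) *\<^sub>R sgn (w x))"
      using H \<psi>(3) that by (intro nonincreasing_part_le) (auto simp: norm_sgn)
    moreover have "(k * norm (w x)) *\<^sub>R sgn (w x) = k *\<^sub>R w x"
      using \<psi>(3) by (simp add: sgn_div_norm flip: divide_inverse)
    ultimately show ?thesis using contra \<psi>(4) by (simp add: g1_def z0_def)
  qed
  have "continuous_on UNIV w" "continuous_on S g1"
    using \<psi>(1) C1' by (auto simp: C1_gradient_on_def)
  then have "continuous_on S (\<lambda>z. (g1 z, w (snd z)))"
    by (intro continuous_on_Pair continuous_on_compose2[of UNIV w S snd])
      (auto intro: continuous_on_snd continuous_on_id)
  then have "((\<lambda>z. (g1 z, w (snd z))) \<longlongrightarrow> (g1 z0, w (snd z0))) (inf (nhds z0) (principal S))"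
    using z0 by (rule continuous_on_tendsto_nhds_within)
  then have lim: "filterlim (\<lambda>z. (g1 z, w (snd z))) (nhds (g1 z0, w x)) (inf (nhds z0) (principal S))"
    by (simp add: z0_def)
  have "\<forall>\<^sub>F z in inf (nhds z0) (principal S). \<forall>k\<ge>0. fst (g1 z) + H (snd (g1 z) - k *\<^sub>R w (snd z)) > 0"
    using eventually_compose_filterlim[OF ray_positivity_stable[OF H(1,2) \<psi>(3) pos] lim] by simp
  moreover have "\<forall>\<^sub>F z in inf (nhds z0) (principal S). us z \<le> ereal (\<phi> z)"
    using touch by (simp add: touches_from_above_def us_def S_def z0_def)
  ultimately have "\<forall>\<^sub>F z in inf (nhds z0) (principal S). us z \<le> ereal (\<phi> z) \<and>
      (\<forall>k\<ge>0. fst (g1 z) + H (snd (g1 z) - k *\<^sub>R w (snd z)) > 0)"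
    by eventually_elim auto
  then obtain d where d: "d > 0" "\<And>z. z \<in> S \<Longrightarrow> dist z z0 < d \<Longrightarrow> us z \<le> ereal (\<phi> z) \<and>
      (\<forall>k\<ge>0. fst (g1 z) + H (snd (g1 z) - k *\<^sub>R w (snd z)) > 0)"
    unfolding eventually_nhds_within_metric by blast
  have "open ({0<..<T} \<times> ball x r)" "z0 \<in> {0<..<T} \<times> ball x r"
    using t \<psi>(2) by (auto simp: z0_def intro!: open_Times)
  then obtain d' where d': "d' > 0" "cball z0 d' \<subseteq> {0<..<T} \<times> ball x r"
    using open_contains_cball by blast
  \<comment> \<open>\<open>d'\<close> keeps the closed ball inside the open time interval and the
    chart, so that \<open>K\<close> below is a compact subset of \<open>S\<close>; halving
    \<open>d\<close> gives the strict inequality \<open>\<rho> < d\<close>.\<close>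
  define \<rho> where "\<rho> = min d' (d / 2)"
  have \<rho>: "\<rho> > 0" "\<rho> < d" "cball z0 \<rho> \<subseteq> {0<..<T} \<times> ball x r"
    using d(1) d' by (auto simp: \<rho>_def)
  define K where "K = cball z0 \<rho> \<inter> (UNIV \<times> closure \<Omega>)"
  have "compact K"
    unfolding K_def by (intro compact_Int_closed closed_Times) auto
  have K: "z \<in> S" "v z \<le> \<phi> z" "snd z \<in> ball x r" "snd z \<in> closure \<Omega>"
      "\<And>k. k \<ge> 0 \<Longrightarrow> fst (g1 z) + H (snd (g1 z) - k *\<^sub>R w (snd z)) > 0" if "z \<in> K" for z
  proof -
    have z: "z \<in> {0<..<T} \<times> ball x r" "snd z \<in> closure \<Omega>" "dist z z0 < d"
      using that \<rho> by (auto simp: K_def dist_commute)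
    then show zS: "z \<in> S" "snd z \<in> ball x r" "snd z \<in> closure \<Omega>" by (auto simp: S_def)
    show "v z \<le> \<phi> z" "\<And>k. k \<ge> 0 \<Longrightarrow> fst (g1 z) + H (snd (g1 z) - k *\<^sub>R w (snd z)) > 0"
      using d(2)[OF zS(1) z(3)] us[OF zS(1)] by auto
  qed

  \<comment> \<open>On the sphere of radius \<open>\<rho>\<close> the quadratic term is then
    \<open>2 * \<epsilon>\<close>, above the allowed loss \<open>\<epsilon>\<close>.\<close>
  define \<epsilon> where "\<epsilon> = \<rho>\<^sup>2 / 2"
  have "\<epsilon> > 0" using \<rho>(1) by (simp add: \<epsilon>_def)
  obtain z1 where z1: "z1 \<in> K" "snd z1 \<in> \<Omega>" "v z1 > \<phi>1 z1 - \<epsilon>"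
  proof -
    define F where "F = inf (nhds z0) (principal ({0<..<T} \<times> \<Omega>))"
    have "(\<phi>1 \<longlongrightarrow> \<phi>1 z0) (inf (nhds z0) (principal S))"
      by (rule continuous_on_tendsto_nhds_within[OF C1_gradient_on_continuous_on[OF C1'] z0])
    moreover have "F \<le> inf (nhds z0) (principal S)"
      using closure_subset[of \<Omega>] unfolding F_def S_def by (intro inf_mono) auto
    ultimately have "(\<phi>1 \<longlongrightarrow> \<phi>1 z0) F" by (meson tendsto_mono)
    then have "\<forall>\<^sub>F z in F. \<phi>1 z < \<phi>1 z0 + \<epsilon> / 2"
      by (rule order_tendstoD) (use \<open>\<epsilon> > 0\<close> in simp)
    moreover have "\<forall>\<^sub>F z in F. z \<in> ball z0 \<rho> \<and> z \<in> {0<..<T} \<times> \<Omega>"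
      using eventually_nhds_in_open[of "ball z0 \<rho>" z0] \<rho>(1)
      unfolding F_def eventually_inf_principal by (auto elim!: eventually_mono)
    \<comment> \<open>Weak continuity enters here: otherwise the \<open>Limsup\<close> along
      interior points would fall below \<open>us z0\<close>. The other half of
      \<open>\<epsilon>\<close> pays for the variation of \<open>\<phi>1\<close>.\<close>
    moreover have "\<exists>\<^sub>F z in F. us z > ereal (\<phi> z0 - \<epsilon> / 2)"
    proof (rule ccontr)
      assume "\<not> ?thesis"
      then have "\<forall>\<^sub>F z in F. us z \<le> ereal (\<phi> z0 - \<epsilon> / 2)"
        by (simp add: not_frequently not_less)
      then have "Limsup F us \<le> ereal (\<phi> z0 - \<epsilon> / 2)" by (rule Limsup_bounded)
      also have "Limsup F us = us z0"
        using weak t x unfolding boundary_weakly_continuous_def us_def F_def S_def z0_def by metis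
      finally show False using us[OF z0] v0 \<open>\<epsilon> > 0\<close> by simp
    qed
    ultimately have "\<exists>\<^sub>F z in F. (us z > ereal (\<phi> z0 - \<epsilon> / 2) \<and> \<phi>1 z < \<phi>1 z0 + \<epsilon> / 2) \<and>
        (z \<in> ball z0 \<rho> \<and> z \<in> {0<..<T} \<times> \<Omega>)"
      using frequently_eventually_frequently by blast
    then obtain z where z: "us z > ereal (\<phi> z0 - \<epsilon> / 2)" "\<phi>1 z < \<phi>1 z0 + \<epsilon> / 2"
        "z \<in> ball z0 \<rho>" "z \<in> {0<..<T} \<times> \<Omega>"
      using frequently_ex by blast
    then have "z \<in> K" using closure_subset[of \<Omega>] by (auto simp: K_def)
    moreover have "v z > \<phi>1 z - \<epsilon>"
      using z us[OF K(1)[OF \<open>z \<in> K\<close>]] by (simp add: \<phi>1_def)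
    ultimately show thesis using that z(4) by auto
  qed
  have \<psi>1: "\<psi> (snd z1) > 0" using inside K(3)[OF z1(1)] z1(2) by blast

  obtain k where k: "k \<ge> 0" "\<epsilon> * exp (- k * \<psi> (snd z1)) < v z1 - \<phi>1 z1 + \<epsilon>"
  proof -
    define \<delta> where "\<delta> = (v z1 - \<phi>1 z1 + \<epsilon>) / \<epsilon>"
    have "\<delta> > 0" using z1(3) \<open>\<epsilon> > 0\<close> by (simp add: \<delta>_def)
    \<comment> \<open>The 1 makes \<open>exp (- s) < \<delta>\<close> strict, and the maximum with 0
      ensures \<open>k \<ge> 0\<close> after division by \<open>\<psi> (snd z1)\<close>.\<close>
    define s where "s = max 0 (1 - ln \<delta>)"
    have "exp (- s) < exp (ln \<delta>)" by (simp add: s_def)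
    then have "\<epsilon> * exp (- s) < \<epsilon> * \<delta>" using \<open>\<delta> > 0\<close> \<open>\<epsilon> > 0\<close> by simp
    then show thesis
      using that[of "s / \<psi> (snd z1)"] \<psi>1 \<open>\<epsilon> > 0\<close> by (simp add: s_def \<delta>_def)
  qed
  define \<phi>2 where "\<phi>2 z = \<phi>1 z + \<epsilon> * exp (- k * \<psi> (snd z))" for z
  \<comment> \<open>The spatial gradient moves by a nonpositive multiple of \<open>w (snd z)\<close>
    and the time derivative is unchanged. Uniform positivity along the ray therefore applies however
    large \<open>k\<close> is.\<close>
  define g2 where "g2 z = g1 z + (- k * \<epsilon> * exp (- k * \<psi> (snd z))) *\<^sub>R (0, w (snd z))" for z
  have "C1_gradient_on S (\<lambda>z. \<epsilon> * exp (- k * \<psi> (snd z)))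
      (\<lambda>z. (- k * \<epsilon> * exp (- k * \<psi> (snd z))) *\<^sub>R (0, w (snd z)))"
    by (rule C1_gradient_on_compose[OF C1_gradient_on_snd[OF \<psi>(1)],
          where h="\<lambda>s. \<epsilon> * exp (- k * s)" and h'="\<lambda>s. - k * \<epsilon> * exp (- k * s)"])
      (auto intro!: derivative_eq_intros continuous_intros)
  then have C1'': "C1_gradient_on S \<phi>2 g2"
    unfolding \<phi>2_def g2_def by (rule C1_gradient_on_add[OF C1'])

  have usc: "\<forall>\<^sub>F y in inf (nhds z) (principal K). v y - \<phi>2 y < c" if "z \<in> K" "v z - \<phi>2 z < c" for z c
  proof -
    \<comment> \<open>Half of the gap is spent on the rise of \<open>v\<close>, half on the drop of
      \<open>\<phi>2\<close>.\<close>
    define \<eta> where "\<eta> = (c - (v z - \<phi>2 z)) / 2"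
    have "\<eta> > 0" using that by (simp add: \<eta>_def)
    have "us z < ereal (v z + \<eta>)" using us[OF K(1)[OF that(1)]] \<open>\<eta> > 0\<close> by simp
    then have "\<forall>\<^sub>F y in inf (nhds z) (principal S). us y < ereal (v z + \<eta>)"
      unfolding us_def by (rule usc_envelope_upper_semicontinuous)
    moreover have "\<forall>\<^sub>F y in inf (nhds z) (principal S). \<phi>2 y > \<phi>2 z - \<eta>"
      using continuous_on_tendsto_nhds_within[OF C1_gradient_on_continuous_on[OF C1''] K(1)[OF that(1)]]
      by (rule order_tendstoD) (use \<open>\<eta> > 0\<close> in simp)
    moreover have "\<forall>\<^sub>F y in inf (nhds z) (principal S). y \<in> S"
      by (simp add: eventually_inf_principal)
    ultimately have "\<forall>\<^sub>F y in inf (nhds z) (principal S). v y - \<phi>2 y < c"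
    proof eventually_elim
      case (elim y)
      then show ?case using us[of y] by (simp add: \<eta>_def field_simps)
    qed
    moreover have "inf (nhds z) (principal K) \<le> inf (nhds z) (principal S)"
      using K(1) by (intro inf_mono) auto
    ultimately show ?thesis using filter_leD by blast
  qed
  have "K \<noteq> {}" using z1(1) by blast
  then obtain z where z: "z \<in> K" and max: "\<And>y. y \<in> K \<Longrightarrow> v y - \<phi>2 y \<le> v z - \<phi>2 z"
    using usc_attains_max[OF \<open>compact K\<close> _ usc] by blast
  have gt: "v z - \<phi>2 z > - \<epsilon>" using max[OF z1(1)] k(2) by (simp add: \<phi>2_def)
  \<comment> \<open>Where \<open>\<psi>\<close> vanishes the exponential equals 1, so
    \<open>v - \<phi>2\<close> would be at most \<open>- \<epsilon>\<close>.\<close>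
  have "\<psi> (snd z) \<noteq> 0"
  proof
    assume "\<psi> (snd z) = 0"
    then have "\<phi>2 z \<ge> \<phi> z + \<epsilon>" by (simp add: \<phi>2_def \<phi>1_def)
    with gt K(2)[OF z] show False by simp
  qed
  then have "snd z \<in> \<Omega>" using inside[of "snd z"] nonneg[of "snd z"] K(3,4)[OF z] by simp
  have "dist z z0 < \<rho>"
  proof (rule ccontr)
    assume "\<not> dist z z0 < \<rho>"
    then have "\<rho>\<^sup>2 \<le> (norm (z - z0))\<^sup>2"
      using \<rho>(1) by (intro power_mono) (auto simp: dist_norm)
    moreover have "\<epsilon> * exp (- k * \<psi> (snd z)) > 0" using \<open>\<epsilon> > 0\<close> by simp
    ultimately have "\<phi>2 z > \<phi> z + 2 * \<epsilon>" by (simp add: \<phi>2_def \<phi>1_def \<epsilon>_def)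
    with gt K(2)[OF z] \<open>\<epsilon> > 0\<close> show False by simp
  qed
  \<comment> \<open>Adding the constant \<open>c\<close> turns the maximum into a contact from
    above.\<close>
  define c where "c = v z - \<phi>2 z"
  have "C1_gradient_on S (\<lambda>y. \<phi>2 y + c) g2"
    using C1'' unfolding C1_gradient_on_def by (auto intro!: derivative_eq_intros)
  moreover have "touches_from_above S (\<lambda>y. \<phi>2 y + c) us z"
    unfolding touches_from_above_def
  proof
    have "\<forall>\<^sub>F y in nhds z. y \<in> ball z0 \<rho>"
      using \<open>dist z z0 < \<rho>\<close> by (intro eventually_nhds_in_open) (auto simp: dist_commute)
    then show "\<forall>\<^sub>F y in inf (nhds z) (principal S). us y \<le> ereal (\<phi>2 y + c)"
      unfolding eventually_inf_principal
    proof eventually_elim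
      case (elim y)
      show ?case
      proof
        assume "y \<in> S"
        then have "y \<in> K" using elim by (auto simp: K_def S_def)
        from max[OF this] us[OF \<open>y \<in> S\<close>] show "us y \<le> ereal (\<phi>2 y + c)" by (simp add: c_def)
      qed
    qed
    show "us z = ereal (\<phi>2 z + c)" using us[OF K(1)[OF z]] by (simp add: c_def)
  qed
  moreover have "fst z \<in> {0<..<T}" using K(1)[OF z] by (auto simp: S_def)
  ultimately have "fst (g2 z) + H (snd (g2 z)) \<le> 0"
    using sub \<open>snd z \<in> \<Omega>\<close> unfolding viscosity_le_def S_def us_def by (metis prod.collapse)
  moreover have "k * \<epsilon> * exp (- k * \<psi> (snd z)) \<ge> 0" using k(1) \<open>\<epsilon> > 0\<close> by simp
  ultimately show False
    using K(5)[OF z, of "k * \<epsilon> * exp (- k * \<psi> (snd z))"] by (simp add: g2_def)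
qed

section \<open>Equivalence of the two problems\<close>

lemma norm_inward_unit_normal:
  fixes \<Omega> :: "'a::euclidean_space set"
  assumes "open \<Omega>" "C1_boundary \<Omega>" "x \<in> frontier \<Omega>"
  shows "norm (inward_unit_normal \<Omega> x) = 1"
  using defining_function[OF assms] by (metis norm_sgn)

theorem theorem1p2:
  fixes T :: real
    and \<Omega> :: "'a::euclidean_space set"
    and H :: "'a \<Rightarrow> real"
    and u :: "real \<times> 'a \<Rightarrow> real"
  assumes "T > 0"
    and "open \<Omega>" and "bounded \<Omega>" and "C1_boundary \<Omega>"
    and "continuous_on UNIV H" and "coercive H" and "quasi_convex H"
    and "locally_bounded_on ({0<..<T} \<times> closure \<Omega>) u"
    and "\<forall>t\<in>{0<..<T}. \<forall>x\<in>frontier \<Omega>.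
           usc_envelope ({0<..<T} \<times> closure \<Omega>) u (t, x) =
           Limsup (inf (nhds (t, x)) (principal ({0<..<T} \<times> \<Omega>)))
             (usc_envelope ({0<..<T} \<times> closure \<Omega>) u)"
  shows "state_constraint_solution T \<Omega> H u \<longleftrightarrow> flux_limited_solution T \<Omega> H u"
proof
  let ?G = "\<lambda>x. nonincreasing_part H (inward_unit_normal \<Omega> x)"
  have weak: "boundary_weakly_continuous T \<Omega> u"
    using assms(9) by (simp add: boundary_weakly_continuous_def)
  have closure: "closure \<Omega> = \<Omega> \<union> frontier \<Omega>"
    by (simp add: closure_Un_frontier)
  show "flux_limited_solution T \<Omega> H u" if "state_constraint_solution T \<Omega> H u"
  proof -
    have super: "viscosity_ge T \<Omega> (\<lambda>x. H) u (closure \<Omega>)" and sub: "viscosity_le T \<Omega> (\<lambda>x. H) u \<Omega>"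
      using that by (auto simp: state_constraint_solution_def)
    then have "viscosity_ge T \<Omega> (\<lambda>x. H) u \<Omega>"
      using closure_subset unfolding viscosity_ge_def by blast
    with sub weak boundary_supersolution[OF assms(2,4) super]
      boundary_subsolution[OF assms(2-8) weak sub]
    show ?thesis by (simp add: flux_limited_solution_def viscosity_eq_def)
  qed
  show "state_constraint_solution T \<Omega> H u" if "flux_limited_solution T \<Omega> H u"
  proof -
    have eq: "viscosity_eq T \<Omega> (\<lambda>x. H) u \<Omega>" and bd: "viscosity_ge T \<Omega> ?G u (frontier \<Omega>)"
      using that by (auto simp: flux_limited_solution_def viscosity_eq_def)
    \<comment> \<open>The case \<open>k = 0\<close> of the ray inequality: a boundary supersolution
      for the nonincreasing part is one for \<open>H\<close>.\<close>
    have "?G x p \<le> H p" if "x \<in> frontier \<Omega>" for x p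
      using nonincreasing_part_le[OF assms(5-7) norm_inward_unit_normal[OF assms(2,4) that], of 0 p]
      by simp
    then have "viscosity_ge T \<Omega> (\<lambda>x. H) u (frontier \<Omega>)"
      using bd unfolding viscosity_ge_def by (meson add_left_mono order_trans)
    with eq show ?thesis
      unfolding state_constraint_solution_def viscosity_eq_def viscosity_ge_def closure by blast
  qed
qed

end
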